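(* Let $X=[x_1,\dots,x_n]$ be a finite set of vectors in $\mathbb{R}^m$ having an MSS $\{X_1,\dots,X_K\}$ (without pure segment), with $\mathcal S_k=\mathrm{span}(X_k)$, $d_k=r(X_k)$, $n_k=n(X_k)$, $d=\sum_k d_k$, such that (i) $x_j\notin\mathcal S_k\cap\mathcal S_\ell$ for all $j\le n$, $k\neq\ell$, and (ii) $\{X_1,\dots,X_K\}$ is intersected nondegenerately. If $d_0\le d_{\min}$ and $n_k>d_k+(K-1)d_0$ for all $k$, then the MSS $\{X_k\}$ of $X$ can be recovered via the reduction procedure starting from any $J\in\mathcal J(K,d,d_{\min})$; that is, whatever partitions are chosen in the procedure, it retrieves after finitely many steps exactly the segments $X_1,\dots,X_K$.
   Context: A real matrix $X=[x_1,\dots,x_n]$ is identified with the (indexed) finite set of its columns; a subset is a column submatrix. $r(X')$ and $n(X')$ denote rank and number of columns, $\mathrm{span}(X')$ the column space, and $X_{J}$ the submatrix of columns indexed by $J$. $X\setminus X'$ denotes the remaining columns. A set $X'$ is nondegenerate if every subset with rank smaller than $r(X')$ is of full column rank. $\mathrm{span}(X')$ (with its spanning set $X'$) is minimal if $n(X')>r(X')$ and $X'$ is nondegenerate. An MSS of $X$ without pure segment is a partition of the columns of $X$ into nonempty segments $X_1,\dots,X_K$ such that each $\mathrm{span}(X_k)$ is minimal and $\mathrm{span}(X_k)\ne\mathrm{span}(X_\ell)$ for $k\neq\ell$. $\{X_k\}$ is intersected nondegenerately if for every $k$ and every subset $X_k'$ of $X\setminus X_k$: with $\mathcal S_k'=\mathrm{span}(X_k)\cap\mathrm{span}(X_k')$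 and $\mathcal S_k''$ the orthogonal complement of $\mathcal S_k'$ within $\mathrm{span}(X_k)$, in the columnwise splitting $X_k=Y_k+Z_k$ with columns of $Y_k$ in $\mathcal S_k'$ and of $Z_k$ in $\mathcal S_k''$, $Z_k$ is zero or nondegenerate. Notation: $d_{\min}=\min_k d_k$, $d_0=\max_k\dim\big(\mathcal S_k\cap\sum_{j\ne k}\mathcal S_j\big)$. $\mathcal J(K,d,d_{\min})$ is the set of all (unordered) partitions $J=\{J_1,\dots,J_K\}$ of the index set of the samples into $K$ pieces with $\min_k|J_k|>d_{\min}$ and $\sum_k r(X_{J_k})\le d$. Reduction procedure: given a current sample set (initially $X$) consisting of the not-yet-retrieved minimal segments, with their number $K$, rank sum $d$ and smallest rank $d_{\min}$, take any $J\in\mathcal J(K,d,d_{\min})$ (defined on the current samples). For every piece $J_i$ with $r(X_{J_i})=d_{\min}$, retrieve as a segment the set of all current samples lying in $\mathrm{span}(X_{J_i})$. Let $K_0$ be the number of distinct segments so retrieved; remove them from the sample set, and repeat on the remaining samples with $K'=K-K_0$, $d'=d-d_{\min}K_0$, and $d_{\min}'$ the smallest rank among the remaining minimal segments, until no samples remain. *)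

theory Defs
  imports "HOL-Analysis.Analysis" "HOL-Library.Disjoint_Sets" "HOL-Library.Set_Algebras"
begin

text \<open>
  A matrix is the family \<open>x\<close> of its columns. A column submatrix is a set \<open>T\<close> of column indices, so
  repeated columns are counted with multiplicity: \<open>card T\<close> is the number of columns.
\<close>

definition col_span :: "('i \<Rightarrow> 'a::euclidean_space) \<Rightarrow> 'i set \<Rightarrow> 'a set" where
  "col_span x T = span (x ` T)"

definition col_rank :: "('i \<Rightarrow> 'a::euclidean_space) \<Rightarrow> 'i set \<Rightarrow> nat" where
  "col_rank x T = dim (col_span x T)"

definition nondegenerate :: "('i \<Rightarrow> 'a::euclidean_space) \<Rightarrow> 'i set \<Rightarrow> bool" where
  "nondegenerate x T \<longleftrightarrow> (\<forall>U\<subseteq>T. col_rank x U < col_rank x T \<longrightarrow> col_rank x U = card U)"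

definition minimal_span :: "('i \<Rightarrow> 'a::euclidean_space) \<Rightarrow> 'i set \<Rightarrow> bool" where
  "minimal_span x T \<longleftrightarrow> card T > col_rank x T \<and> nondegenerate x T"

definition mss_without_pure :: "('i \<Rightarrow> 'a::euclidean_space) \<Rightarrow> 'i set \<Rightarrow> nat \<Rightarrow> (nat \<Rightarrow> 'i set) \<Rightarrow> bool" where
  "mss_without_pure x I K S \<longleftrightarrow>
     (\<Union>k\<in>{1..K}. S k) = I \<and> disjoint_family_on S {1..K} \<and> (\<forall>k\<in>{1..K}. S k \<noteq> {}) \<and>
     (\<forall>k\<in>{1..K}. minimal_span x (S k)) \<and>
     (\<forall>k\<in>{1..K}. \<forall>l\<in>{1..K}. k \<noteq> l \<longrightarrow> col_span x (S k) \<noteq> col_span x (S l))"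

text \<open>
  On \<open>S k\<close> the splitting \<open>x = y + z\<close> below exists and is unique, so quantifying universally over it is
  the same as speaking about the splitting.
\<close>

definition intersected_nondegenerately ::
    "('i \<Rightarrow> 'a::euclidean_space) \<Rightarrow> 'i set \<Rightarrow> nat \<Rightarrow> (nat \<Rightarrow> 'i set) \<Rightarrow> bool" where
  "intersected_nondegenerately x I K S \<longleftrightarrow>
     (\<forall>k\<in>{1..K}. \<forall>T \<subseteq> I - S k.
        let V' = col_span x (S k) \<inter> col_span x T;
            V'' = col_span x (S k) \<inter> V'\<^sup>\<bottom>
        in \<forall>y z. (\<forall>j\<in>S k. x j = y j + z j \<and> y j \<in> V' \<and> z j \<in> V'') \<longrightarrow>
             (\<forall>j\<in>S k. z j = 0) \<or> nondegenerate z (S k))"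

definition min_rank :: "('i \<Rightarrow> 'a::euclidean_space) \<Rightarrow> 'i set set \<Rightarrow> nat" where
  "min_rank x M = Min (col_rank x ` M)"

text \<open>The inner sum is the sum of subspaces (Minkowski sum); it is \<open>{0}\<close> when \<open>K = 1\<close>.\<close>

definition max_overlap :: "('i \<Rightarrow> 'a::euclidean_space) \<Rightarrow> nat \<Rightarrow> (nat \<Rightarrow> 'i set) \<Rightarrow> nat" where
  "max_overlap x K S =
     Max ((\<lambda>k. dim (col_span x (S k) \<inter> (\<Sum>j\<in>{1..K} - {k}. col_span x (S j)))) ` {1..K})"

definition admissible_partitions ::
    "('i \<Rightarrow> 'a::euclidean_space) \<Rightarrow> 'i set \<Rightarrow> nat \<Rightarrow> nat \<Rightarrow> nat \<Rightarrow> 'i set set set" where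
  "admissible_partitions x A K d dmin =
     {J. partition_on A J \<and> card J = K \<and> (\<forall>P\<in>J. card P > dmin) \<and> (\<Sum>P\<in>J. col_rank x P) \<le> d}"

definition retrieved_segments ::
    "('i \<Rightarrow> 'a::euclidean_space) \<Rightarrow> 'i set \<Rightarrow> 'i set set \<Rightarrow> nat \<Rightarrow> 'i set set" where
  "retrieved_segments x A J dmin =
     (\<lambda>P. {j \<in> A. x j \<in> col_span x P}) ` {P \<in> J. col_rank x P = dmin}"

text \<open>
  States of the reduction procedure are tuples of the current samples, the current number of segments,
  the current rank sum, and the set of segments retrieved so far. \<open>M\<close> is the set of all minimal
  segments; it enters only through the smallest rank of the segments not yet retrieved. The choice of
  \<open>J\<close> makes the procedure nondeterministic. A step that retrieves nothing is a legal step.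
\<close>

inductive reduction_step ::
    "('i \<Rightarrow> 'a::euclidean_space) \<Rightarrow> 'i set set \<Rightarrow>
     'i set \<times> nat \<times> nat \<times> 'i set set \<Rightarrow> 'i set \<times> nat \<times> nat \<times> 'i set set \<Rightarrow> bool"
  for x :: "'i \<Rightarrow> 'a" and M :: "'i set set" where
  "\<lbrakk> A \<noteq> {}; dmin = min_rank x (M - R);
     J \<in> admissible_partitions x A K d dmin;
     N = retrieved_segments x A J dmin \<rbrakk> \<Longrightarrow>
   reduction_step x M (A, K, d, R) (A - \<Union>N, K - card N, d - dmin * card N, R \<union> N)"

end

theory Submission imports Defs begin

text \<open>
  Nondegenerate intersection gives a dichotomy: for columns \<open>U \<subseteq> S k\<close> and columns \<open>T\<close> of other
  segments, either \<open>T \<union> U\<close> spans all of \<open>span S k\<close>, or \<open>U\<close> adds its full column count to the rank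
  of \<open>T\<close>. Adding the segments one by one, a piece with more columns than its rank therefore spans
  some \<open>S k\<close>; if its rank is \<open>dmin\<close>, its span equals that of \<open>S k\<close>.

  Such a piece exists; otherwise every piece would have rank more than \<open>dmin\<close>, hence more than
  \<open>d0\<close>. If some \<open>S k\<close> is spanned by no piece, all its columns count fully towards the ranks, and
  \<open>card (S k) > d k + (K - 1) * d0\<close> makes up for a loss of at most \<open>d0\<close> on each other segment, so the
  rank sum exceeds \<open>d\<close>. Otherwise assign to each \<open>k\<close> a piece spanning \<open>S k\<close>. A piece with \<open>c > 0\<close>
  assigned segments has rank at least the sum of their ranks minus \<open>(c - 1) * d0\<close>. Summing over all
  pieces, the bound \<open>d\<close> on the rank sum forces the assignment to be bijective and every such inequality
  to be an equality, so the piece assigned to a segment of rank \<open>dmin\<close> has rank \<open>dmin\<close>.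
\<close>

section \<open>Column spans, ranks and sums of subspaces\<close>

lemma col_span_mono: "T \<subseteq> U \<Longrightarrow> col_span x T \<subseteq> col_span x U"
  unfolding col_span_def by (intro span_mono image_mono)

lemma subspace_col_span [simp]: "subspace (col_span x T)"
  unfolding col_span_def by simp

lemma col_span_subset_iff: "col_span x T \<subseteq> col_span x U \<longleftrightarrow> x ` T \<subseteq> col_span x U"
  unfolding col_span_def by (meson span_minimal span_superset subset_trans subspace_span)

lemma col_rank_le: "col_span x T \<subseteq> col_span x U \<Longrightarrow> col_rank x T \<le> col_rank x U"
  unfolding col_rank_def by (rule dim_subset)

lemma col_rank_Un:
  "col_rank x (T \<union> U) + dim (col_span x T \<inter> col_span x U) = col_rank x T + col_rank x U"
  using dim_sums_Int[of "col_span x T" "col_span x U"]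
  by (simp add: col_rank_def col_span_def image_Un span_Un)

lemma span_UN_eq_sum:
  assumes "finite I"
  shows "span (\<Union>i\<in>I. B i) = (\<Sum>i\<in>I. span (B i))"
  using assms
proof (induction I)
  case empty
  then show ?case by (simp add: set_zero)
next
  case (insert i I)
  have "span (\<Union>i\<in>insert i I. B i) = span (B i) + span (\<Union>i\<in>I. B i)"
    by (auto simp: span_Un set_plus_def)
  then show ?case using insert by simp
qed

text \<open>Capping the terms at \<open>b\<close> does no harm: either one term alone reaches
  \<open>b\<close>, or no term is changed.\<close>

lemma le_sum_min:
  fixes b :: nat
  assumes "finite J" "b \<le> (\<Sum>P\<in>J. a P)"
  shows "b \<le> (\<Sum>P\<in>J. min (a P) b)"
proof (cases "\<exists>P\<in>J. b \<le> a P")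
  case True
  then obtain P where P: "P \<in> J" "b \<le> a P" by blast
  have "min (a P) b \<le> (\<Sum>P\<in>J. min (a P) b)"
    using member_le_sum[OF P(1), of "\<lambda>P. min (a P) b"] assms(1) by simp
  then show ?thesis using P by simp
next
  case False
  then have "(\<Sum>P\<in>J. min (a P) b) = (\<Sum>P\<in>J. a P)"
    by (intro sum.cong) auto
  then show ?thesis using assms(2) by simp
qed

section \<open>Nondegenerate intersection and the rank dichotomy\<close>

text \<open>Since \<open>y j\<close> lies in the span of \<open>T\<close>, the columns
  \<open>x j\<close> and \<open>z j\<close> agree modulo that span. If the residues of
  \<open>U\<close> have the rank of all residues of \<open>S\<close>, they generate these and hence
  \<open>S\<close> is covered; otherwise nondegeneracy makes them independent, and orthogonality to
  \<open>V'\<close> makes their span meet that of \<open>T\<close> only in 0.\<close>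

lemma nondegenerate_residue_dichotomy:
  fixes x y z :: "'i \<Rightarrow> 'a::euclidean_space" and S T U :: "'i set"
  defines "V' \<equiv> col_span x S \<inter> col_span x T"
  assumes U: "U \<subseteq> S" "finite U"
    and split: "\<And>j. j \<in> S \<Longrightarrow> x j = y j + z j \<and> y j \<in> V' \<and> z j \<in> col_span x S \<inter> V'\<^sup>\<bottom>"
    and z: "(\<forall>j\<in>S. z j = 0) \<or> nondegenerate z S"
  shows "col_span x S \<subseteq> col_span x (T \<union> U) \<or> col_rank x (T \<union> U) = col_rank x T + card U"
proof -
  have W: "subspace (col_span x (T \<union> U))" "col_span x T \<subseteq> col_span x (T \<union> U)"
    by (simp_all add: col_span_mono)
  have y_in: "y j \<in> col_span x T" if "j \<in> S" for j
    using split[OF that] unfolding V'_def by auto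
  have xU: "x j \<in> col_span x (T \<union> U)" if "j \<in> U" for j
    using that unfolding col_span_def by (auto intro: span_base)
  have zU_sub: "col_span z U \<subseteq> col_span x (T \<union> U)"
  proof -
    have "z j \<in> col_span x (T \<union> U)" if j: "j \<in> U" for j
    proof -
      have "z j = x j - y j" using split[of j] j U by auto
      then show ?thesis
        using subspace_diff[OF W(1) xU[OF j]] y_in[of j] W(2) U(1) j by auto
    qed
    then show ?thesis unfolding col_span_def[of z] by (intro span_minimal) (auto simp: W(1))
  qed
  have covers: "col_span x S \<subseteq> col_span x (T \<union> U)"
    if zS: "\<And>j. j \<in> S \<Longrightarrow> z j \<in> col_span x (T \<union> U)"
  proof -
    have "x j \<in> col_span x (T \<union> U)" if j: "j \<in> S" for j
      using split[OF j] y_in[OF j] W(2) zS[OF j] subspace_add[OF W(1)] by auto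
    then show ?thesis unfolding col_span_subset_iff by auto
  qed
  consider "\<forall>j\<in>S. z j = 0" | "nondegenerate z S" "col_rank z U = col_rank z S"
    | "col_rank z U = card U"
    using z U col_rank_le[OF col_span_mono[OF U(1), of z]] unfolding nondegenerate_def
    by (metis le_neq_implies_less)
  then show ?thesis
  proof cases
    case 1
    then show ?thesis using covers subspace_0[OF W(1)] by auto
  next
    case 2
    have "col_span z U = col_span z S"
      by (rule subspace_dim_equal) (use 2 col_span_mono[OF U(1), of z] in \<open>auto simp: col_rank_def\<close>)
    then have "z j \<in> col_span x (T \<union> U)" if "j \<in> S" for j
      using zU_sub that unfolding col_span_def[of z S] by (metis imageI in_mono span_base)
    then show ?thesis using covers by blast
  next
    case 3
    have "subspace (col_span x S \<inter> V'\<^sup>\<bottom>)"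
      by (intro subspace_inter subspace_orthogonal_comp) simp
    then have zV: "col_span z U \<subseteq> col_span x S \<inter> V'\<^sup>\<bottom>"
      unfolding col_span_def[of z] using split U by (intro span_minimal) auto
    \<comment> \<open>A common vector lies in \<open>col_span x S\<close> because the residues do,
      hence in \<open>V'\<close>; it is also orthogonal to \<open>V'\<close>.\<close>
    have "v = 0" if "v \<in> col_span x T" "v \<in> col_span z U" for v
    proof -
      have "v \<in> V'" "v \<in> V'\<^sup>\<bottom>" using that zV unfolding V'_def by auto
      then show ?thesis unfolding orthogonal_comp_def using orthogonal_self by blast
    qed
    then have int0: "col_span x T \<inter> col_span z U = {0}"
      using subspace_0[OF subspace_col_span] by fastforce
    have "col_span x (T \<union> U) = {v + w |v w. v \<in> col_span x T \<and> w \<in> col_span z U}" (is "_ = ?R")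
    proof
      have "subspace ?R" using subspace_sums[of "col_span x T" "col_span z U"] by simp
      moreover have "x j \<in> ?R" if "j \<in> T" for j
      proof -
        have "x j \<in> col_span x T" using that by (simp add: col_span_def span_base)
        moreover have "0 \<in> col_span z U" by (rule subspace_0) simp
        ultimately show ?thesis by force
      qed
      moreover have "x j \<in> ?R" if "j \<in> U" for j
      proof -
        have "z j \<in> col_span z U" using that by (simp add: col_span_def span_base)
        moreover have "x j = y j + z j" "y j \<in> col_span x T" using split y_in that U by auto
        ultimately show ?thesis by blast
      qed
      ultimately show "col_span x (T \<union> U) \<subseteq> ?R"
        unfolding col_span_def[of x "T \<union> U"] by (intro span_minimal) auto
      show "?R \<subseteq> col_span x (T \<union> U)"
        using W zU_sub by (auto intro: subspace_add)
    qed
    then have "col_rank x (T \<union> U) = col_rank x T + col_rank z U"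
      using dim_sums_Int[of "col_span x T" "col_span z U"] int0 by (simp add: col_rank_def)
    then show ?thesis using 3 by simp
  qed
qed

text \<open>Orthogonal projection onto \<open>V'\<close> supplies a splitting to which the
  universally quantified hypothesis applies.\<close>

lemma intersected_nondegenerately_dichotomy:
  assumes inter: "intersected_nondegenerately x I K S"
    and k: "k \<in> {1..K}" and T: "T \<subseteq> I - S k" and U: "U \<subseteq> S k" "finite U"
  shows "col_span x (S k) \<subseteq> col_span x (T \<union> U) \<or> col_rank x (T \<union> U) = col_rank x T + card U"
proof -
  define V' where "V' = col_span x (S k) \<inter> col_span x T"
  have sub: "subspace V'" unfolding V'_def by (intro subspace_inter) simp_all
  then have spanV: "span V' = V'" by simp
  have "\<exists>y z. x j = y + z \<and> y \<in> V' \<and> z \<in> col_span x (S k) \<inter> V'\<^sup>\<bottom>" if j: "j \<in> S k" for j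
  proof -
    obtain y z where yz: "y \<in> span V'" "\<And>w. w \<in> span V' \<Longrightarrow> orthogonal z w" "x j = y + z"
      using orthogonal_subspace_decomp_exists by blast
    have "x j \<in> col_span x (S k)" using j by (simp add: col_span_def span_base)
    moreover have "y \<in> col_span x (S k)" using yz spanV unfolding V'_def by auto
    ultimately have "z \<in> col_span x (S k)"
      using yz(3) subspace_diff[OF subspace_col_span] by (metis add_diff_cancel_left')
    moreover have "z \<in> V'\<^sup>\<bottom>"
      using yz(2) spanV by (simp add: orthogonal_comp_def orthogonal_commute)
    ultimately show ?thesis using yz(1,3) spanV by blast
  qed
  then obtain y z where yz: "\<And>j. j \<in> S k \<Longrightarrow>
      x j = y j + z j \<and> y j \<in> V' \<and> z j \<in> col_span x (S k) \<inter> V'\<^sup>\<bottom>"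
    by metis
  then have "(\<forall>j\<in>S k. z j = 0) \<or> nondegenerate z (S k)"
    using inter k T unfolding intersected_nondegenerately_def Let_def V'_def by blast
  then show ?thesis
    using nondegenerate_residue_dichotomy[OF U, of x y z T] yz unfolding V'_def by blast
qed

text \<open>Passing to fewer columns can only shrink the intersection, so the one constant also
  serves every subfamily of segments.\<close>

lemma max_overlap_bound:
  assumes "k \<in> {1..K}" "T \<subseteq> \<Union> (S ` ({1..K} - {k}))"
  shows "dim (col_span x (S k) \<inter> col_span x T) \<le> max_overlap x K S"
proof -
  have "col_span x T \<subseteq> span (\<Union>j\<in>{1..K} - {k}. x ` S j)"
    unfolding col_span_def using assms(2) by (intro span_mono) blast
  also have "\<dots> = (\<Sum>j\<in>{1..K} - {k}. col_span x (S j))"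
    unfolding col_span_def by (rule span_UN_eq_sum) simp
  finally have "dim (col_span x (S k) \<inter> col_span x T)
      \<le> dim (col_span x (S k) \<inter> (\<Sum>j\<in>{1..K} - {k}. col_span x (S j)))"
    by (intro dim_subset) auto
  also have "\<dots> \<le> max_overlap x K S"
    unfolding max_overlap_def using assms(1) by (intro Max_ge) auto
  finally show ?thesis .
qed

section \<open>Rank estimates for a family of segments\<close>

text \<open>The index set \<open>L\<close> is arbitrary so that the results apply to the segments
  left at any stage of the procedure. As \<open>d0\<close> is only an upper bound on overlaps, it
  can stay fixed throughout.\<close>

locale segment_family =
  fixes x :: "'i \<Rightarrow> 'a::euclidean_space" and S :: "'k \<Rightarrow> 'i set" and L :: "'k set" and d0 :: nat
  assumes finL: "finite L"
    and finS: "k \<in> L \<Longrightarrow> finite (S k)"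
    and nonempty: "k \<in> L \<Longrightarrow> S k \<noteq> {}"
    and disj: "disjoint_family_on S L"
    and separated: "k \<in> L \<Longrightarrow> l \<in> L \<Longrightarrow> k \<noteq> l \<Longrightarrow> j \<in> S l \<Longrightarrow> x j \<notin> col_span x (S k)"
    and overlap: "k \<in> L \<Longrightarrow> T \<subseteq> \<Union> (S ` (L - {k})) \<Longrightarrow>
          dim (col_span x (S k) \<inter> col_span x T) \<le> d0"
    and dichotomy: "k \<in> L \<Longrightarrow> T \<subseteq> \<Union> (S ` (L - {k})) \<Longrightarrow> U \<subseteq> S k \<Longrightarrow>
          col_span x (S k) \<subseteq> col_span x (T \<union> U) \<or> col_rank x (T \<union> U) = col_rank x T + card U"
    and size: "k \<in> L \<Longrightarrow> card (S k) > col_rank x (S k) + (card L - 1) * d0"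
    and d0_le: "k \<in> L \<Longrightarrow> d0 \<le> col_rank x (S k)"
begin

lemma disjD: "k \<in> L \<Longrightarrow> l \<in> L \<Longrightarrow> k \<noteq> l \<Longrightarrow> S k \<inter> S l = {}"
  using disj unfolding disjoint_family_on_def by blast

lemma inj_S: "inj_on S L"
  by (rule inj_onI) (metis disjD nonempty Int_absorb)

lemma finite_Union_S: "finite (\<Union> (S ` L))"
  using finL finS by auto

text \<open>Each segment added either is spanned by the columns collected so far, which persists
  when more are added, or raises the rank by its number of columns in \<open>P\<close>.\<close>

lemma full_rank_or_spans_segment:
  assumes "P \<subseteq> \<Union> (S ` L)"
  shows "card P \<le> col_rank x P \<or> (\<exists>k\<in>L. col_span x (S k) \<subseteq> col_span x P)"
proof -
  have "card (P \<inter> \<Union> (S ` M)) \<le> col_rank x (P \<inter> \<Union> (S ` M)) \<or>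
      (\<exists>k\<in>L. col_span x (S k) \<subseteq> col_span x (P \<inter> \<Union> (S ` M)))" if "M \<subseteq> L" for M
    using finite_subset[OF that finL] that
  proof (induction M)
    case empty
    then show ?case by simp
  next
    case (insert k M)
    let ?T = "P \<inter> \<Union> (S ` M)" and ?U = "P \<inter> S k"
    have split: "P \<inter> \<Union> (S ` insert k M) = ?T \<union> ?U" by auto
    have T: "?T \<subseteq> \<Union> (S ` (L - {k}))" using insert by blast
    have k: "k \<in> L" using insert by blast
    have mono: "col_span x ?T \<subseteq> col_span x (?T \<union> ?U)" by (intro col_span_mono) simp
    consider "col_span x (S k) \<subseteq> col_span x (?T \<union> ?U)"
      | "col_rank x (?T \<union> ?U) = col_rank x ?T + card ?U"
      using dichotomy[OF k T, of ?U] by blast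
    then show ?case
    proof cases
      case 1
      then show ?thesis using k split by metis
    next
      case 2
      have "card ?T \<le> col_rank x ?T \<or> (\<exists>k\<in>L. col_span x (S k) \<subseteq> col_span x ?T)"
        using insert by blast
      then show ?thesis
      proof
        assume "card ?T \<le> col_rank x ?T"
        then show ?thesis using 2 card_Un_le[of ?T ?U] unfolding split by linarith
      next
        assume "\<exists>k\<in>L. col_span x (S k) \<subseteq> col_span x ?T"
        then show ?thesis using mono unfolding split by blast
      qed
    qed
  qed
  from this[of L] show ?thesis using assms by (simp add: Int_absorb2)
qed

text \<open>When \<open>S k\<close> is added, either its columns in \<open>P\<close> count fully, or
  its span is covered and it contributes its rank minus an overlap of at most \<open>d0\<close>. The
  minimum covers both cases.\<close>

lemma col_rank_ge_sum_min:
  assumes "M \<subseteq> L" "P \<subseteq> \<Union> (S ` M)"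
  shows "(\<Sum>l\<in>M. min (card (P \<inter> S l)) (col_rank x (S l) - d0)) \<le> col_rank x P"
proof -
  have "(\<Sum>l\<in>M. min (card (P \<inter> S l)) (col_rank x (S l) - d0)) \<le> col_rank x (P \<inter> \<Union> (S ` M))"
    using finite_subset[OF assms(1) finL] assms(1)
  proof (induction M)
    case empty
    then show ?case by simp
  next
    case (insert k M)
    let ?T = "P \<inter> \<Union> (S ` M)" and ?U = "P \<inter> S k"
    have split: "P \<inter> \<Union> (S ` insert k M) = ?T \<union> ?U" by auto
    have T: "?T \<subseteq> \<Union> (S ` (L - {k}))" using insert by blast
    have k: "k \<in> L" using insert by blast
    have "col_rank x ?T + min (card ?U) (col_rank x (S k) - d0) \<le> col_rank x (?T \<union> ?U)"
    proof (cases "col_span x (S k) \<subseteq> col_span x (?T \<union> ?U)")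
      \<comment> \<open>All of \<open>S k\<close> can now be added to \<open>?T\<close> without
        leaving the span of \<open>?T \<union> ?U\<close>, so the overlap bound for whole segments
        applies.\<close>
      case True
      have "x ` S k \<subseteq> col_span x (?T \<union> ?U)" using True unfolding col_span_subset_iff .
      moreover have "x ` ?T \<subseteq> col_span x (?T \<union> ?U)"
        unfolding col_span_def by (auto intro!: span_base)
      ultimately have "col_span x (?T \<union> S k) \<subseteq> col_span x (?T \<union> ?U)"
        unfolding col_span_subset_iff image_Un by (rule Un_least[rotated])
      then have "col_rank x (?T \<union> S k) \<le> col_rank x (?T \<union> ?U)" by (rule col_rank_le)
      moreover have "dim (col_span x ?T \<inter> col_span x (S k)) \<le> d0"
        using overlap[OF k T] by (simp add: Int_commute)
      ultimately show ?thesis using col_rank_Un[of x ?T "S k"] d0_le[OF k] by linarith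
    next
      case False
      then show ?thesis using dichotomy[OF k T, of ?U] by auto
    qed
    moreover have "(\<Sum>l\<in>M. min (card (P \<inter> S l)) (col_rank x (S l) - d0)) \<le> col_rank x ?T"
      using insert by blast
    ultimately show ?case unfolding split using insert by simp
  qed
  then show ?thesis using assms(2) by (simp add: Int_absorb2)
qed

text \<open>Every segment after the first meets the span of the others already joined in dimension
  at most \<open>d0\<close>. The term \<open>d0\<close> on the left avoids the subtraction in
  \<open>card C - 1\<close>.\<close>

lemma sum_col_rank_le:
  assumes "C \<subseteq> L" "C \<noteq> {}"
  shows "(\<Sum>k\<in>C. col_rank x (S k)) + d0 \<le> col_rank x (\<Union> (S ` C)) + card C * d0"
  using finite_subset[OF assms(1) finL] assms(2) assms(1)
proof (induction C rule: finite_ne_induct)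
  case (singleton k)
  then show ?case by simp
next
  case (insert k C)
  have k: "k \<in> L" and T: "\<Union> (S ` C) \<subseteq> \<Union> (S ` (L - {k}))" using insert by auto
  have "dim (col_span x (S k) \<inter> col_span x (\<Union> (S ` C))) \<le> d0"
    by (rule overlap[OF k T])
  moreover have "(\<Sum>k\<in>C. col_rank x (S k)) + d0 \<le> col_rank x (\<Union> (S ` C)) + card C * d0"
    using insert by blast
  ultimately show ?case using insert col_rank_Un[of x "S k" "\<Union> (S ` C)"] by simp
qed

section \<open>Pieces of an admissible partition\<close>

text \<open>Having more than \<open>dmin\<close> columns, a piece either has rank above
  \<open>dmin\<close> or contains the span of a segment, whose dimension is at least
  \<open>dmin\<close>. At rank \<open>dmin\<close> this inclusion is an equality by
  dimension.\<close>

lemma admissible_piece_rank_eq_min_span: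
  assumes J: "J \<in> admissible_partitions x (\<Union> (S ` L)) (card L) (\<Sum>k\<in>L. col_rank x (S k)) dmin"
    and dmin: "dmin = min_rank x (S ` L)"
    and P: "P \<in> J"
  shows "dmin \<le> col_rank x P"
    and "col_rank x P = dmin \<Longrightarrow> \<exists>k\<in>L. col_rank x (S k) = dmin \<and> col_span x P = col_span x (S k)"
proof -
  have le: "dmin \<le> col_rank x (S k)" if "k \<in> L" for k
    unfolding dmin min_rank_def using finL that by (intro Min_le) auto
  have Psub: "P \<subseteq> \<Union> (S ` L)"
    using J P partition_onD1 unfolding admissible_partitions_def by blast
  have card: "card P > dmin" using J P unfolding admissible_partitions_def by blast
  show "dmin \<le> col_rank x P"
    using full_rank_or_spans_segment[OF Psub] card le col_rank_le by (meson le_trans less_imp_le)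
  show "\<exists>k\<in>L. col_rank x (S k) = dmin \<and> col_span x P = col_span x (S k)" if eq: "col_rank x P = dmin"
  proof -
    obtain k where k: "k \<in> L" "col_span x (S k) \<subseteq> col_span x P"
      using full_rank_or_spans_segment[OF Psub] card eq by force
    have "col_span x (S k) = col_span x P"
      by (rule subspace_dim_equal) (use k eq le[of k] in \<open>auto simp: col_rank_def\<close>)
    then show ?thesis using k eq unfolding col_rank_def by metis
  qed
qed

text \<open>A step that retrieves nothing is legal by definition; this result excludes it.\<close>

lemma exists_piece_of_min_rank:
  assumes ne: "L \<noteq> {}"
    and J: "J \<in> admissible_partitions x (\<Union> (S ` L)) (card L) (\<Sum>k\<in>L. col_rank x (S k)) dmin"
    and dmin: "dmin = min_rank x (S ` L)"
  shows "\<exists>P\<in>J. col_rank x P = dmin"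
proof (rule ccontr)
  assume "\<not> ?thesis"
  then have gt: "dmin < col_rank x P" if "P \<in> J" for P
    using admissible_piece_rank_eq_min_span(1)[OF J dmin that] that by (metis le_neq_implies_less)
  have "dmin \<in> col_rank x ` (S ` L)"
    unfolding dmin min_rank_def using finL ne by (intro Min_in) auto
  then obtain k0 where k0: "k0 \<in> L" "col_rank x (S k0) = dmin" by auto
  have d0: "d0 \<le> dmin" using d0_le[OF k0(1)] k0(2) by simp
  have part: "partition_on (\<Union> (S ` L)) J" and cardJ: "card J = card L"
    and sum_le: "(\<Sum>P\<in>J. col_rank x P) \<le> (\<Sum>k\<in>L. col_rank x (S k))"
    using J unfolding admissible_partitions_def by auto
  have finJ: "finite J" using finite_elements[OF finite_Union_S part] .
  have UJ: "\<Union>J = \<Union> (S ` L)" using partition_onD1[OF part] by simp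
  have count: "card (S k) = (\<Sum>P\<in>J. card (P \<inter> S k))" if k: "k \<in> L" for k
  proof -
    have "S k = (\<Union>P\<in>J. P \<inter> S k)" using UJ k by blast
    moreover have "card (\<Union>P\<in>J. P \<inter> S k) = (\<Sum>P\<in>J. card (P \<inter> S k))"
      using partition_onD2[OF part] finJ finS[OF k]
      by (intro card_UN_disjoint) (auto simp: disjoint_def)
    ultimately show ?thesis by simp
  qed
  show False
  proof (cases "\<exists>k\<in>L. \<forall>P\<in>J. \<not> col_span x (S k) \<subseteq> col_span x P")
    case True
    then obtain k where k: "k \<in> L" and no: "\<And>P. P \<in> J \<Longrightarrow> \<not> col_span x (S k) \<subseteq> col_span x P"
      by blast
    let ?b = "\<lambda>l. col_rank x (S l) - d0"
    \<comment> \<open>As \<open>P\<close> does not span \<open>S k\<close>, the dichotomy counts its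
      columns there in full on top of the rank of \<open>P - S k\<close>, which the capped sum
      bounds from below.\<close>
    have lower: "(\<Sum>l\<in>L - {k}. min (card (P \<inter> S l)) (?b l)) + card (P \<inter> S k) \<le> col_rank x P"
      if P: "P \<in> J" for P
    proof -
      have sub: "P - S k \<subseteq> \<Union> (S ` (L - {k}))" using UJ P by blast
      have "col_rank x P = col_rank x (P - S k) + card (P \<inter> S k)"
        using dichotomy[OF k sub, of "P \<inter> S k"] no[OF P] by (simp add: Un_Diff_Int)
      moreover have "(P - S k) \<inter> S l = P \<inter> S l" if "l \<in> L - {k}" for l
        using disjD[of k l] that k by blast
      then have "(\<Sum>l\<in>L - {k}. min (card (P \<inter> S l)) (?b l))
          = (\<Sum>l\<in>L - {k}. min (card ((P - S k) \<inter> S l)) (?b l))"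
        by (intro sum.cong) auto
      ultimately show ?thesis using col_rank_ge_sum_min[OF _ sub] by auto
    qed
    have "?b l \<le> (\<Sum>P\<in>J. min (card (P \<inter> S l)) (?b l))" if "l \<in> L" for l
    proof (rule le_sum_min[OF finJ])
      show "?b l \<le> (\<Sum>P\<in>J. card (P \<inter> S l))" using size[OF that] count[OF that] by simp
    qed
    then have "(\<Sum>l\<in>L - {k}. ?b l) \<le> (\<Sum>l\<in>L - {k}. \<Sum>P\<in>J. min (card (P \<inter> S l)) (?b l))"
      by (intro sum_mono) auto
    also have "\<dots> = (\<Sum>P\<in>J. \<Sum>l\<in>L - {k}. min (card (P \<inter> S l)) (?b l))"
      by (rule sum.swap)
    finally have "(\<Sum>l\<in>L - {k}. ?b l) + card (S k)
        \<le> (\<Sum>P\<in>J. (\<Sum>l\<in>L - {k}. min (card (P \<inter> S l)) (?b l)) + card (P \<inter> S k))"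
      by (simp add: count[OF k] sum.distrib)
    also have "\<dots> \<le> (\<Sum>P\<in>J. col_rank x P)"
      by (intro sum_mono lower)
    finally have "(\<Sum>l\<in>L - {k}. ?b l) + card (S k) \<le> (\<Sum>P\<in>J. col_rank x P)" .
    \<comment> \<open>Using \<open>?b l\<close> for the rank loses \<open>d0\<close> on each of the
      \<open>card L - 1\<close> other segments; the excess of columns in \<open>S k\<close> over its
      rank strictly outweighs this.\<close>
    moreover have "(\<Sum>l\<in>L - {k}. col_rank x (S l)) = (\<Sum>l\<in>L - {k}. ?b l + d0)"
      using d0_le by (intro sum.cong) auto
    then have "(\<Sum>l\<in>L - {k}. col_rank x (S l)) = (\<Sum>l\<in>L - {k}. ?b l) + (card L - 1) * d0"
      using k finL by (simp add: sum.distrib)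
    moreover have "(\<Sum>l\<in>L. col_rank x (S l)) = col_rank x (S k) + (\<Sum>l\<in>L - {k}. col_rank x (S l))"
      using k finL by (rule sum.remove[rotated])
    ultimately show False using size[OF k] sum_le by linarith
  next
    case False
    then obtain f where f: "\<And>k. k \<in> L \<Longrightarrow> f k \<in> J \<and> col_span x (S k) \<subseteq> col_span x (f k)"
      by metis
    define C where "C P = {k \<in> L. f k = P}" for P
    \<comment> \<open>For an empty \<open>C P\<close> this says that \<open>d0\<close> is at most
      the rank of \<open>P\<close>, which holds because that rank exceeds
      \<open>dmin\<close>.\<close>
    have bound: "(\<Sum>k\<in>C P. col_rank x (S k)) + d0 \<le> col_rank x P + card (C P) * d0" if "P \<in> J" for P
    proof (cases "C P = {}")
      case True
      then show ?thesis using gt[OF that] d0 by simp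
    next
      case False
      have CL: "C P \<subseteq> L" unfolding C_def by auto
      have "x ` \<Union> (S ` C P) \<subseteq> col_span x P"
        using f unfolding C_def col_span_subset_iff by auto
      then have "col_rank x (\<Union> (S ` C P)) \<le> col_rank x P"
        by (simp add: col_rank_le col_span_subset_iff)
      then show ?thesis using sum_col_rank_le[OF CL False] by linarith
    qed
    \<comment> \<open>A piece without assigned segments has rank above \<open>d0\<close>. If there
      is none, equal cardinalities make \<open>f\<close> a bijection, and the piece that holds only
      \<open>k0\<close> has rank above \<open>dmin\<close>, the rank of \<open>S k0\<close>.\<close>
    have strict: "\<exists>P\<in>J. (\<Sum>k\<in>C P. col_rank x (S k)) + d0 < col_rank x P + card (C P) * d0"
    proof (cases "\<exists>P\<in>J. C P = {}")
      case True
      then obtain P where "P \<in> J" "C P = {}" by blast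
      then show ?thesis using gt[of P] d0 by (intro bexI[of _ P]) auto
    next
      case False
      then have "J \<subseteq> f ` L" unfolding C_def by auto
      moreover have "f ` L \<subseteq> J" using f by auto
      ultimately have "f ` L = J" by (rule equalityI[rotated])
      then have "inj_on f L" using cardJ finL by (simp add: eq_card_imp_inj_on)
      then have "C (f k0) = {k0}" using k0 unfolding C_def inj_on_def by auto
      then show ?thesis using f[OF k0(1)] gt[of "f k0"] k0(2) by (intro bexI[of _ "f k0"]) auto
    qed
    have group: "(\<Sum>P\<in>J. \<Sum>k\<in>C P. g k) = (\<Sum>k\<in>L. g k)" for g :: "'k \<Rightarrow> nat"
      unfolding C_def using f by (intro sum.group finL finJ) auto
    \<comment> \<open>The \<open>d0\<close> terms cancel after summation: both \<open>card J\<close>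
      and the sum of the \<open>card (C P)\<close> equal \<open>card L\<close>.\<close>
    have "(\<Sum>P\<in>J. (\<Sum>k\<in>C P. col_rank x (S k)) + d0) < (\<Sum>P\<in>J. col_rank x P + card (C P) * d0)"
      using bound strict by (intro sum_strict_mono_ex1 finJ) auto
    moreover have "(\<Sum>P\<in>J. card (C P)) = card L" using group[of "\<lambda>_. 1"] by simp
    ultimately have "(\<Sum>k\<in>L. col_rank x (S k)) < (\<Sum>P\<in>J. col_rank x P)"
      using group[of "\<lambda>k. col_rank x (S k)"] cardJ
      by (simp add: sum.distrib flip: sum_distrib_right)
    then show False using sum_le by simp
  qed
qed

text \<open>A piece of rank \<open>dmin\<close> has the span of some segment, and by
  \<open>separated\<close> the samples in that span are exactly this segment. Pieces with equal
  spans yield one and the same element of the image.\<close>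

lemma retrieved_segments_eq:
  assumes ne: "L \<noteq> {}"
    and J: "J \<in> admissible_partitions x (\<Union> (S ` L)) (card L) (\<Sum>k\<in>L. col_rank x (S k)) dmin"
    and dmin: "dmin = min_rank x (S ` L)"
  obtains L' where "L' \<subseteq> L" "L' \<noteq> {}" "\<And>k. k \<in> L' \<Longrightarrow> col_rank x (S k) = dmin"
    "retrieved_segments x (\<Union> (S ` L)) J dmin = S ` L'"
proof -
  let ?N = "retrieved_segments x (\<Union> (S ` L)) J dmin"
  have segment: "{j \<in> \<Union> (S ` L). x j \<in> col_span x (S k)} = S k" if k: "k \<in> L" for k
  proof
    show "{j \<in> \<Union> (S ` L). x j \<in> col_span x (S k)} \<subseteq> S k"
      using separated k by (smt (verit) UN_E mem_Collect_eq subsetI)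
    show "S k \<subseteq> {j \<in> \<Union> (S ` L). x j \<in> col_span x (S k)}"
      using k by (auto simp: col_span_def span_base)
  qed
  have "?N \<subseteq> S ` {k \<in> L. col_rank x (S k) = dmin}"
  proof
    fix B assume "B \<in> ?N"
    then obtain P where P: "P \<in> J" "col_rank x P = dmin"
      "B = {j \<in> \<Union> (S ` L). x j \<in> col_span x P}"
      unfolding retrieved_segments_def by auto
    obtain k where "k \<in> L" "col_rank x (S k) = dmin" "col_span x P = col_span x (S k)"
      using admissible_piece_rank_eq_min_span(2)[OF J dmin P(1,2)] by blast
    then show "B \<in> S ` {k \<in> L. col_rank x (S k) = dmin}" using segment[of k] P(3) by auto
  qed
  then obtain L' where L': "L' \<subseteq> {k \<in> L. col_rank x (S k) = dmin}" "?N = S ` L'"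
    by (rule subset_imageE)
  have "?N \<noteq> {}"
    using exists_piece_of_min_rank[OF ne J dmin] unfolding retrieved_segments_def by auto
  then show thesis using that[of L'] L' by auto
qed

text \<open>Provides a legal choice of partition, so the procedure cannot get stuck while segments
  remain.\<close>

lemma segments_admissible:
  assumes "L \<noteq> {}"
  shows "S ` L \<in> admissible_partitions x (\<Union> (S ` L)) (card L) (\<Sum>k\<in>L. col_rank x (S k))
    (min_rank x (S ` L))"
proof -
  have "partition_on (\<Union> (S ` L)) (S ` L)"
    using disjD nonempty by (intro partition_onI) (fastforce simp: disjnt_def)+
  moreover have "min_rank x (S ` L) < card (S k)" if "k \<in> L" for k
  proof -
    have "min_rank x (S ` L) \<le> col_rank x (S k)"
      unfolding min_rank_def using finL that by (intro Min_le) auto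
    then show ?thesis using size[OF that] by simp
  qed
  ultimately show ?thesis
    unfolding admissible_partitions_def using inj_S by (auto simp: card_image sum.reindex)
qed

end

section \<open>Termination and correctness of the procedure\<close>

text \<open>Since the choice of partitions is free, recovery is expressed as absence of infinite
  runs together with correctness of every reachable state that has no successor.\<close>

theorem theorem6:
  fixes x :: "nat \<Rightarrow> real ^ 'm" and n K d dmin d0 :: nat and S :: "nat \<Rightarrow> nat set"
  assumes mss: "mss_without_pure x {1..n} K S"
    and d_def: "d = (\<Sum>k\<in>{1..K}. col_rank x (S k))"
    and dmin_def: "dmin = min_rank x (S ` {1..K})"
    and d0_def: "d0 = max_overlap x K S"
    and not_in_two: "\<And>j k l. \<lbrakk> j \<in> {1..n}; k \<in> {1..K}; l \<in> {1..K}; k \<noteq> l \<rbrakk> \<Longrightarrow>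
           x j \<notin> col_span x (S k) \<inter> col_span x (S l)"
    and inter: "intersected_nondegenerately x {1..n} K S"
    and d0_le: "d0 \<le> dmin"
    and size: "\<And>k. k \<in> {1..K} \<Longrightarrow> card (S k) > col_rank x (S k) + (K - 1) * d0"
  shows
    "(\<nexists>run. run 0 = ({1..n}, K, d, {}) \<and>
        (\<forall>i::nat. reduction_step x (S ` {1..K}) (run i) (run (Suc i)))) \<and>
     (\<forall>A K' d' R.
        (reduction_step x (S ` {1..K}))\<^sup>*\<^sup>* ({1..n}, K, d, {}) (A, K', d', R) \<and>
        (\<nexists>s. reduction_step x (S ` {1..K}) (A, K', d', R) s)
        \<longrightarrow> A = {} \<and> R = S ` {1..K})"
proof -
  have UN: "(\<Union>k\<in>{1..K}. S k) = {1..n}" and disjK: "disjoint_family_on S {1..K}"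
    and neK: "\<And>k. k \<in> {1..K} \<Longrightarrow> S k \<noteq> {}"
    using mss unfolding mss_without_pure_def by blast+
  have sub_n: "S k \<subseteq> {1..n}" if "k \<in> {1..K}" for k using UN that by blast
  have family: "segment_family x S L d0" if L: "L \<subseteq> {1..K}" for L
  proof
    show "finite L" using L finite_subset by blast
    show "disjoint_family_on S L" using disjoint_family_on_mono[OF L disjK] .
    fix k assume kL: "k \<in> L"
    then have k: "k \<in> {1..K}" using L by blast
    show "finite (S k)" using sub_n[OF k] finite_subset by blast
    show "S k \<noteq> {}" using neK[OF k] .
    have "card L \<le> K" using card_mono[OF _ L] by simp
    then have "(card L - 1) * d0 \<le> (K - 1) * d0" by (intro mult_right_mono) auto
    then show "col_rank x (S k) + (card L - 1) * d0 < card (S k)" using size[OF k] by linarith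
    have "dmin \<le> col_rank x (S k)"
      unfolding dmin_def min_rank_def using k by (intro Min_le) auto
    then show "d0 \<le> col_rank x (S k)" using d0_le by simp
    fix T assume T: "T \<subseteq> \<Union> (S ` (L - {k}))"
    show "dim (col_span x (S k) \<inter> col_span x T) \<le> d0"
      unfolding d0_def by (rule max_overlap_bound[OF k]) (use T L in blast)
    fix U assume U: "U \<subseteq> S k"
    have "S l \<inter> S k = {}" if "l \<in> L - {k}" for l
      using disjK L k that unfolding disjoint_family_on_def by blast
    then have "T \<subseteq> {1..n} - S k" using T L sub_n by blast
    then show "col_span x (S k) \<subseteq> col_span x (T \<union> U) \<or> col_rank x (T \<union> U) = col_rank x T + card U"
      using intersected_nondegenerately_dichotomy[OF inter k _ U] sub_n[OF k] U
      by (meson finite_atLeastAtMost finite_subset)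
  next
    fix k l j assume kl: "k \<in> L" "l \<in> L" "k \<noteq> l" "j \<in> S l"
    then have "x j \<in> col_span x (S l)" by (simp add: col_span_def span_base)
    moreover have "k \<in> {1..K}" "l \<in> {1..K}" using kl L by auto
    moreover have "j \<in> {1..n}" using sub_n[of l] \<open>l \<in> {1..K}\<close> kl by blast
    ultimately show "x j \<notin> col_span x (S k)" using not_in_two[of j k l] kl by blast
  qed
  interpret all: segment_family x S "{1..K}" d0 by (rule family) simp
  let ?M = "S ` {1..K}"
  \<comment> \<open>The invariant: a reachable state is determined by the index set \<open>L\<close>
    of the segments not yet retrieved.\<close>
  define state where "state L = (\<Union> (S ` L), card L, \<Sum>k\<in>L. col_rank x (S k), S ` ({1..K} - L))" for L
  have remaining: "?M - S ` ({1..K} - L) = S ` L" if "L \<subseteq> {1..K}" for L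
    using inj_on_image_set_diff[OF all.inj_S, of "{1..K}" "{1..K} - L"] that
    by (simp add: double_diff)
  have state_step: "\<exists>L'. L' \<subset> L \<and> s = state L'" if L: "L \<subseteq> {1..K}" and st: "reduction_step x ?M (state L) s" for L s
  proof -
    interpret segment_family x S L d0 by (rule family[OF L])
    from st obtain J where "\<Union> (S ` L) \<noteq> {}"
      and J: "J \<in> admissible_partitions x (\<Union> (S ` L)) (card L) (\<Sum>k\<in>L. col_rank x (S k)) (min_rank x (S ` L))"
      and s: "s = (let N = retrieved_segments x (\<Union> (S ` L)) J (min_rank x (S ` L)) in
        (\<Union> (S ` L) - \<Union>N, card L - card N, (\<Sum>k\<in>L. col_rank x (S k)) - min_rank x (S ` L) * card N,
         S ` ({1..K} - L) \<union> N))"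
      unfolding state_def Let_def by (cases rule: reduction_step.cases) (auto simp: remaining[OF L, unfolded One_nat_def])
    then have ne: "L \<noteq> {}" by auto
    obtain N where N: "N \<subseteq> L" "N \<noteq> {}" "\<And>k. k \<in> N \<Longrightarrow> col_rank x (S k) = min_rank x (S ` L)"
      "retrieved_segments x (\<Union> (S ` L)) J (min_rank x (S ` L)) = S ` N"
      using retrieved_segments_eq[OF ne J refl] by metis
    have finN: "finite N" using N(1) finL finite_subset by blast
    have "\<Union> (S ` L) - \<Union> (S ` N) = \<Union> (S ` (L - N))"
    proof -
      have "S k \<inter> S l = {}" if "k \<in> L - N" "l \<in> N" for k l using disjD[of k l] that N(1) by blast
      then show ?thesis by blast
    qed
    \<comment> \<open>Injectivity of \<open>S\<close> on \<open>L\<close> makes the number of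
      retrieved sets equal to \<open>card N\<close>; with \<open>N \<subseteq> L\<close> the
      natural-number subtractions in the new state are exact.\<close>
    moreover have cN: "card (S ` N) = card N"
      using inj_S N(1) by (meson card_image inj_on_subset)
    moreover have "card L - card N = card (L - N)" using card_Diff_subset[OF finN N(1)] by simp
    moreover have "(\<Sum>k\<in>L. col_rank x (S k)) - min_rank x (S ` L) * card N = (\<Sum>k\<in>L - N. col_rank x (S k))"
    proof -
      have "(\<Sum>k\<in>N. col_rank x (S k)) = min_rank x (S ` L) * card N" using N(3) by simp
      then show ?thesis using sum.subset_diff[OF N(1) finL, of "\<lambda>k. col_rank x (S k)"] by simp
    qed
    moreover have "S ` ({1..K} - L) \<union> S ` N = S ` ({1..K} - (L - N))" using N(1) L by blast
    ultimately have "s = state (L - N)" unfolding s N(4) state_def Let_def by simp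
    then show ?thesis using N(1,2) by blast
  qed
  have progress: "\<exists>s. reduction_step x ?M (state L) s" if L: "L \<subseteq> {1..K}" "L \<noteq> {}" for L
  proof -
    interpret segment_family x S L d0 by (rule family[OF L(1)])
    have "\<Union> (S ` L) \<noteq> {}" using L(2) nonempty by blast
    from reduction_step.intros[OF this _ segments_admissible[OF L(2)] refl] show ?thesis
      unfolding state_def using remaining[OF L(1)] by metis
  qed
  have init: "state {1..K} = ({1..n}, K, d, {})" unfolding state_def using UN d_def by simp
  have "\<nexists>run. run 0 = ({1..n}, K, d, {}) \<and> (\<forall>i::nat. reduction_step x ?M (run i) (run (Suc i)))"
  proof
    assume "\<exists>run. run 0 = ({1..n}, K, d, {}) \<and> (\<forall>i::nat. reduction_step x ?M (run i) (run (Suc i)))"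
    then obtain run where run: "run 0 = state {1..K}" "\<And>i::nat. reduction_step x ?M (run i) (run (Suc i))"
      using init by auto
    \<comment> \<open>Each step loses at least one index, so \<open>i\<close> steps leave at most
      \<open>K - i\<close>; index \<open>Suc K\<close> is then impossible.\<close>
    have "\<exists>L. L \<subseteq> {1..K} \<and> run i = state L \<and> card L + i \<le> K" for i
    proof (induction i)
      case 0
      then show ?case using run(1) by (intro exI[of _ "{1..K}"]) auto
    next
      case (Suc i)
      then obtain L where L: "L \<subseteq> {1..K}" "run i = state L" "card L + i \<le> K" by blast
      then obtain L' where L': "L' \<subset> L" "run (Suc i) = state L'" using state_step run(2) by metis
      moreover have "card L' < card L" using L' L(1) by (meson finite_atLeastAtMost finite_subset psubset_card_mono)
      ultimately show ?case using L by (intro exI[of _ L']) auto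
    qed
    from this[of "Suc K"] show False by auto
  qed
  moreover have "A = {} \<and> R = ?M"
    if run: "(reduction_step x ?M)\<^sup>*\<^sup>* ({1..n}, K, d, {}) (A, K', d', R)"
      and stuck: "\<nexists>s. reduction_step x ?M (A, K', d', R) s" for A K' d' R
  proof -
    have "\<exists>L\<subseteq>{1..K}. s = state L" if "(reduction_step x ?M)\<^sup>*\<^sup>* (state {1..K}) s" for s
      using that
    proof (induction rule: rtranclp_induct)
      case base
      then show ?case by blast
    next
      case (step s t)
      then obtain L where "L \<subseteq> {1..K}" "s = state L" by blast
      then show ?case using \<open>reduction_step x ?M s t\<close> state_step
        by (meson order_trans psubset_imp_subset)
    qed
    then obtain L where L: "L \<subseteq> {1..K}" "(A, K', d', R) = state L" using run init by metis
    then have "L = {}" using progress stuck by metis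
    then show ?thesis using L(2) unfolding state_def by simp
  qed
  ultimately show ?thesis by blast
qed

end
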